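(* Let $a,b,c$ be positive integers with $c\ge 2$ and $\gcd(b,c)=1$. Then $G_{a,b}(c)=H(a,b,c)$.
   Context: $\mathbb{N}$ denotes the set of non-negative integers (including $0$). For positive integers $a,b$ let $\theta_{a,b}:\mathbb{N}\to\mathbb{N}$, $x\mapsto ax+b$. A subsemigroup $G$ of $(\mathbb{N},+)$ containing $0$ is called a $\theta_{a,b}$-semigroup if $\theta_{a,b}(y)\in G$ for every $y\in G\setminus\{0\}$. $G_{a,b}(c)$ denotes the smallest (with respect to inclusion) $\theta_{a,b}$-semigroup containing $c$. For $k\in\mathbb{N}$ set $s_0(a)=0$ and $s_k(a)=\sum_{i=0}^{k-1}a^i$ for $k\ge 1$, and $t_k(a,b,c)=a^kc+b\cdot s_k(a)$. Let $S(a,b,c)=\{t_k(a,b,c):k\in\mathbb{N}\}$. For $S\subseteq\mathbb{N}$, $\langle S\rangle$ denotes the set of all finite linear combinations of elements of $S$ with coefficients in $\mathbb{N}$ (so $0\in\langle S\rangle$). $H(a,b,c)=\langle S(a,b,c)\rangle$. *)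

theory Defs
  imports Complex_Main
begin

definition theta :: "nat \<Rightarrow> nat \<Rightarrow> nat \<Rightarrow> nat" where
  "theta a b x = a * x + b"

definition theta_semigroup :: "nat \<Rightarrow> nat \<Rightarrow> nat set \<Rightarrow> bool" where
  "theta_semigroup a b G \<longleftrightarrow>
     0 \<in> G \<and> (\<forall>x\<in>G. \<forall>y\<in>G. x + y \<in> G) \<and> (\<forall>y\<in>G - {0}. theta a b y \<in> G)"

text \<open>The order on \<^typ>\<open>nat set\<close> is inclusion; the least element exists by
  \<open>theta_gen_least\<close> below.\<close>

definition theta_gen :: "nat \<Rightarrow> nat \<Rightarrow> nat \<Rightarrow> nat set" where
  "theta_gen a b c = (LEAST G. theta_semigroup a b G \<and> c \<in> G)"

lemma theta_gen_eq_Inter: "theta_gen a b c = \<Inter> {G. theta_semigroup a b G \<and> c \<in> G}"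
  unfolding theta_gen_def
  by (rule Least_equality) (auto simp: theta_semigroup_def)

lemma theta_gen_least:
  "theta_semigroup a b (theta_gen a b c)"
  "c \<in> theta_gen a b c"
  "theta_semigroup a b G \<Longrightarrow> c \<in> G \<Longrightarrow> theta_gen a b c \<subseteq> G"
  unfolding theta_gen_eq_Inter by (auto simp: theta_semigroup_def)

text \<open>\<open>geo_sum\<close>, \<open>orbit\<close>, \<open>orbit_set\<close>, \<open>orbit_span\<close> are the paper's
  \<open>s\<close>, \<open>t\<close>, \<open>S\<close>, \<open>H\<close>; \<open>theta_gen\<close> is its \<open>G\<close>.\<close>

definition geo_sum :: "nat \<Rightarrow> nat \<Rightarrow> nat" where
  "geo_sum k a = (\<Sum>i<k. a ^ i)"

definition orbit :: "nat \<Rightarrow> nat \<Rightarrow> nat \<Rightarrow> nat \<Rightarrow> nat" where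
  "orbit k a b c = a ^ k * c + b * geo_sum k a"

definition orbit_set :: "nat \<Rightarrow> nat \<Rightarrow> nat \<Rightarrow> nat set" where
  "orbit_set a b c = {orbit k a b c | k. True}"

definition nat_span :: "nat set \<Rightarrow> nat set" where
  "nat_span A = {\<Sum>x\<in>F. f x * x | F f. finite F \<and> F \<subseteq> A}"

definition orbit_span :: "nat \<Rightarrow> nat \<Rightarrow> nat \<Rightarrow> nat set" where
  "orbit_span a b c = nat_span (orbit_set a b c)"

end

theory Submission
  imports Defs
begin

text \<open>
  The elements of the orbit are the iterates of \<open>c\<close> under \<open>x \<mapsto> a x + b\<close>, and all of them are
  positive, so any \<open>\<theta>\<close>-semigroup containing \<open>c\<close> contains the orbit and hence its span.
  For the other inclusion the span has to be closed under \<open>\<theta>\<close>. A nonzero element of the span can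
  be written \<open>x + z\<close> with \<open>x\<close> in the orbit and \<open>z\<close> in the span, and
  \<open>\<theta> (x + z) = \<theta> x + a z\<close>. Here \<open>\<theta> x\<close> is the next element of the orbit, and \<open>a z\<close> is a
  multiple of an element of the span.
\<close>

lemma nat_span_zero: "0 \<in> nat_span A"
  unfolding nat_span_def by (auto intro!: exI[of _ "{}"])

lemma nat_span_superset: "A \<subseteq> nat_span A"
proof
  fix x assume "x \<in> A"
  moreover have "x = (\<Sum>y\<in>{x}. 1 * y)" by simp
  ultimately show "x \<in> nat_span A"
    unfolding nat_span_def by (intro CollectI exI[of _ "{x}"] exI[of _ "\<lambda>_. 1"]) simp
qed

lemma nat_span_add:
  assumes "x \<in> nat_span A" and "y \<in> nat_span A"
  shows "x + y \<in> nat_span A"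
proof -
  obtain F f where F: "finite F" "F \<subseteq> A" and x: "x = (\<Sum>u\<in>F. f u * u)"
    using assms(1) unfolding nat_span_def by blast
  obtain F' f' where F': "finite F'" "F' \<subseteq> A" and y: "y = (\<Sum>u\<in>F'. f' u * u)"
    using assms(2) unfolding nat_span_def by blast
  let ?g = "\<lambda>u. (if u \<in> F then f u else 0) + (if u \<in> F' then f' u else 0)"
  have "x = (\<Sum>u\<in>F \<union> F'. (if u \<in> F then f u else 0) * u)"
    unfolding x using F F' by (intro sum.mono_neutral_cong_left) auto
  moreover have "y = (\<Sum>u\<in>F \<union> F'. (if u \<in> F' then f' u else 0) * u)"
    unfolding y using F F' by (intro sum.mono_neutral_cong_left) auto
  ultimately have "x + y = (\<Sum>u\<in>F \<union> F'. ?g u * u)"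
    by (simp only: sum.distrib distrib_right)
  then show ?thesis
    unfolding nat_span_def using F F'
    by (intro CollectI exI[of _ "F \<union> F'"] exI[of _ ?g]) simp
qed

lemma nat_span_mult:
  assumes "x \<in> nat_span A"
  shows "n * x \<in> nat_span A"
  by (induction n) (simp_all add: nat_span_zero nat_span_add assms)

lemma nat_span_minimal:
  assumes "A \<subseteq> G" and "0 \<in> G" and add: "\<And>x y. x \<in> G \<Longrightarrow> y \<in> G \<Longrightarrow> x + y \<in> G"
  shows "nat_span A \<subseteq> G"
proof
  fix z assume "z \<in> nat_span A"
  then obtain F f where F: "finite F" "F \<subseteq> A" and z: "z = (\<Sum>x\<in>F. f x * x)"
    unfolding nat_span_def by blast
  have mult: "n * x \<in> G" if "x \<in> G" for n x
    by (induction n) (simp_all add: assms(2) add that)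
  have "(\<Sum>x\<in>F. f x * x) \<in> G"
    using F by (induction F) (use assms mult in auto)
  then show "z \<in> G" by (simp only: z)
qed

lemma nat_span_nonzero_split:
  assumes "y \<in> nat_span A" and "y \<noteq> 0"
  obtains x z where "x \<in> A" and "z \<in> nat_span A" and "y = x + z"
proof -
  obtain F f where F: "finite F" "F \<subseteq> A" and y: "y = (\<Sum>x\<in>F. f x * x)"
    using assms(1) unfolding nat_span_def by blast
  obtain x where x: "x \<in> F" "f x * x \<noteq> 0"
    using assms(2) unfolding y by (meson sum.neutral)
  let ?g = "f(x := f x - 1)"
  have "(\<Sum>u\<in>F. ?g u * u) = (f x - 1) * x + (\<Sum>u\<in>F - {x}. f u * u)"
    using F x by (subst sum.remove[of F x]) (auto intro: sum.cong)
  moreover have "y = f x * x + (\<Sum>u\<in>F - {x}. f u * u)"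
    unfolding y using F x by (subst sum.remove[of F x]) auto
  moreover have "f x * x = x + (f x - 1) * x"
    using x(2) by (cases "f x") auto
  ultimately have "y = x + (\<Sum>u\<in>F. ?g u * u)" by simp
  moreover have "(\<Sum>u\<in>F. ?g u * u) \<in> nat_span A"
    using F unfolding nat_span_def by blast
  ultimately show thesis using that F x by blast
qed

lemma orbit_0: "orbit 0 a b c = c"
  by (simp add: orbit_def geo_sum_def)

lemma orbit_Suc: "orbit (Suc k) a b c = theta a b (orbit k a b c)"
proof -
  have "geo_sum (Suc k) a = 1 + a * geo_sum k a"
    unfolding geo_sum_def by (subst sum.lessThan_Suc_shift) (simp add: sum_distrib_left)
  then show ?thesis by (simp add: orbit_def theta_def algebra_simps)
qed

lemma orbit_pos: "a > 0 \<Longrightarrow> c > 0 \<Longrightarrow> orbit k a b c > 0"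
  by (simp add: orbit_def)

lemma theta_semigroup_orbit_span: "theta_semigroup a b (orbit_span a b c)"
  unfolding theta_semigroup_def orbit_span_def
proof (intro conjI ballI)
  fix y assume "y \<in> nat_span (orbit_set a b c) - {0}"
  then obtain x z where x: "x \<in> orbit_set a b c" and z: "z \<in> nat_span (orbit_set a b c)"
    and y: "y = x + z"
    by (blast elim: nat_span_nonzero_split)
  from x have "theta a b x \<in> orbit_set a b c"
    unfolding orbit_set_def by (auto simp flip: orbit_Suc)
  then have "theta a b x + a * z \<in> nat_span (orbit_set a b c)"
    using z nat_span_superset by (blast intro: nat_span_add nat_span_mult)
  then show "theta a b y \<in> nat_span (orbit_set a b c)"
    by (simp add: y theta_def algebra_simps)
qed (simp_all add: nat_span_zero nat_span_add)

lemma orbit_set_subset_theta_semigroup: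
  assumes "theta_semigroup a b G" and "c \<in> G" and "a > 0" and "c > 0"
  shows "orbit_set a b c \<subseteq> G"
proof -
  have "orbit k a b c \<in> G" for k
  proof (induction k)
    case 0
    show ?case using assms(2) by (simp add: orbit_0)
  next
    case (Suc k)
    \<comment> \<open>Closure under \<open>\<theta>\<close> is only available at nonzero elements.\<close>
    have "orbit k a b c \<noteq> 0" using orbit_pos[OF assms(3,4)] by simp
    with Suc assms(1) show ?case by (simp add: theta_semigroup_def orbit_Suc)
  qed
  then show ?thesis unfolding orbit_set_def by blast
qed

theorem theorem3p1:
  fixes a b c :: nat
  assumes "a > 0" and "b > 0" and "c \<ge> 2" and "gcd b c = 1"
  shows "theta_gen a b c = orbit_span a b c"
proof
  have "c \<in> orbit_set a b c"
    unfolding orbit_set_def using orbit_0[of a b c, symmetric] by blast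
  then have "c \<in> orbit_span a b c"
    unfolding orbit_span_def using nat_span_superset by blast
  then show "theta_gen a b c \<subseteq> orbit_span a b c"
    using theta_semigroup_orbit_span by (blast dest: theta_gen_least(3))
next
  have "orbit_set a b c \<subseteq> theta_gen a b c"
    using theta_gen_least(1,2) assms by (intro orbit_set_subset_theta_semigroup) auto
  then show "orbit_span a b c \<subseteq> theta_gen a b c"
    unfolding orbit_span_def using theta_gen_least(1)[of a b c]
    by (intro nat_span_minimal) (auto simp: theta_semigroup_def)
qed

end
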